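(* Let $n\ge 1$ and let $A,B\subset\mathbb{R}^n$ be centrally symmetric convex bodies. (1) If $|A+K|\le |B+K|$ for all convex bodies $K\subset\mathbb{R}^n$, then $A\subseteq B$. (2) Moreover, let $K_0\subset\mathbb{R}^n$ be any fixed convex body. If $|A+K|\le |B+K|$ for every linear image $K=LK_0$ of $K_0$ ($L:\mathbb{R}^n\to\mathbb{R}^n$ linear), then $A\subseteq B$.
   Context: A convex body in $\mathbb{R}^n$ is a compact convex set with non-empty interior. A convex body $K$ is centrally symmetric if $K=-K$. $|\cdot|$ denotes $n$-dimensional volume and $A+K$ is the Minkowski sum. *)

theory Defs
  imports "HOL-Analysis.Analysis"
begin

definition convex_body :: "(real ^ 'n) set \<Rightarrow> bool" where
  "convex_body K \<longleftrightarrow> compact K \<and> convex K \<and> interior K \<noteq> {}"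

text \<open>On sets, \<open>- K\<close> is the complement in Isabelle/HOL, so the reflection of \<open>K\<close> in the origin
  is written as an image. The sum \<open>A + K\<close> of sets, by contrast, is the Minkowski sum
  (theory \<open>Set_Algebras\<close>).\<close>

definition centrally_symmetric :: "(real ^ 'n) set \<Rightarrow> bool" where
  "centrally_symmetric K \<longleftrightarrow> K = uminus ` K"

end

theory Submission
  imports Defs
begin

text \<open>If some \<open>a \<in> A\<close> is not in \<open>B\<close>, separate them by a functional \<open>u\<close> with \<open>u \<bullet> a = 1\<close> and
  \<open>\<bar>u \<bullet> b\<bar> \<le> \<beta> < 1\<close> on \<open>B\<close>. Add a large copy \<open>t M\<close> of a flat body \<open>M \<subseteq> {x. u \<bullet> x = 0}\<close> that is a
  linear image of \<open>K\<^sub>0\<close>. As \<open>A\<close> contains the segment from \<open>-a\<close> to \<open>a\<close>, the volume of \<open>A + t M\<close> is at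
  least \<open>t\<^sup>n\<^sup>-\<^sup>1 V\<close>, where \<open>V > 0\<close> is the volume of this segment plus \<open>M\<close>. On the other hand, the
  projection of \<open>B\<close> along \<open>a\<close> lies in a translate of some \<open>c M\<close>, so by convexity of \<open>M\<close> the volume of
  \<open>B + t M\<close> is at most \<open>\<beta> (t + c)\<^sup>n\<^sup>-\<^sup>1 V\<close>, which is smaller for large \<open>t\<close>. The inequality survives
  replacing \<open>B\<close> by a neighbourhood \<open>B + \<delta> U\<close>, with \<open>U\<close> the unit ball; moving \<open>\<delta> U\<close> to the other summand turns
  \<open>t M\<close> into a body with interior, as the first part requires.\<close>

section \<open>Minkowski sums and coordinate stretches\<close>

lemma compact_set_plus:
  fixes S T :: "'a::real_normed_vector set"
  assumes "compact S" "compact T"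
  shows "compact (S + T)"
proof -
  have "S + T = {x + y | x y. x \<in> S \<and> y \<in> T}"
    by (auto simp: set_plus_def)
  then show ?thesis using compact_sums[OF assms] by simp
qed

text \<open>With \<open>s = 0\<close> this is \<open>t\<close> times the projection along axis
  \<open>k\<close>, so it flattens \<open>K\<close> into the hyperplane where coordinate
  \<open>k\<close> vanishes. Nonzero \<open>s\<close> is used to rescale a cylinder separately in
  height and in cross-section.\<close>

definition stretch :: "'n \<Rightarrow> real \<Rightarrow> real \<Rightarrow> real ^ 'n \<Rightarrow> real ^ 'n" where
  "stretch k s t x = (\<chi> i. (if i = k then s else t) * x $ i)"

lemma stretch_nth [simp]: "stretch k s t x $ i = (if i = k then s else t) * x $ i"
  by (simp add: stretch_def)

lemma linear_stretch: "linear (stretch k s t)"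
  by (rule linearI) (auto simp: vec_eq_iff algebra_simps)

lemma measure_stretch_image:
  fixes S :: "(real ^ 'n) set"
  assumes "S \<in> lmeasurable"
  shows "measure lebesgue (stretch k s t ` S) = \<bar>s\<bar> * \<bar>t\<bar> ^ (CARD('n) - 1) * measure lebesgue S"
proof -
  have "(\<Prod>i\<in>UNIV. if i = k then s else t) = s * t ^ (CARD('n) - 1)"
    by (subst prod.remove[of _ k]) (auto simp: card_Diff_singleton prod.If_cases)
  then show ?thesis
    unfolding stretch_def [abs_def] using measure_stretch[OF assms, of "\<lambda>i. if i = k then s else t"]
    by (simp add: abs_mult power_abs)
qed

section \<open>The volume gap when the slab is orthogonal to a coordinate axis\<close>

lemma exists_power_gt:
  fixes \<beta> c :: real
  assumes "\<beta> < 1"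
  shows "\<exists>t>0. \<beta> * (t + c) ^ N < t ^ N"
proof -
  \<comment> \<open>After division by \<open>t ^ N\<close> the left side tends to \<beta> < 1, so
    every large \<open>t\<close> works.\<close>
  have "((\<lambda>t. 1 + c / t) \<longlongrightarrow> 1 + 0) at_top"
    by (intro tendsto_intros tendsto_divide_0[OF tendsto_const]) (simp add: filterlim_at_top_imp_at_infinity filterlim_ident)
  then have "((\<lambda>t. \<beta> * (1 + c / t) ^ N) \<longlongrightarrow> \<beta> * (1 + 0) ^ N) at_top"
    by (rule tendsto_mult[OF tendsto_const tendsto_power])
  then have "eventually (\<lambda>t. \<beta> * (1 + c / t) ^ N < 1) at_top"
    using assms by (intro order_tendstoD(2)) auto
  then have "eventually (\<lambda>t. t > 0 \<and> \<beta> * (1 + c / t) ^ N < 1) at_top"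
    by (intro eventually_conj eventually_gt_at_top)
  then obtain t :: real where t: "t > 0" "\<beta> * (1 + c / t) ^ N < 1"
    using eventually_happens'[OF trivial_limit_at_top_linorder] by blast
  have "\<beta> * (t + c) ^ N = \<beta> * (1 + c / t) ^ N * t ^ N"
    using t by (simp add: power_mult_distrib[symmetric] algebra_simps)
  also have "\<dots> < 1 * t ^ N"
    using t by (intro mult_strict_right_mono) auto
  finally show ?thesis using t by auto
qed

text \<open>Both sums are compared with stretched copies of one cylinder \<open>D\<close>. The
  height factor is 1 for \<open>A\<close> and \<beta> for \<open>B\<close>, while the cross-section
  factors \<open>t\<close> and \<open>t + c\<close> have ratio tending to 1.\<close>

lemma stretch_gap:
  fixes A B K :: "(real ^ 'n) set"
  assumes A: "compact A" and seg: "\<And>\<sigma>. \<bar>\<sigma>\<bar> \<le> 1 \<Longrightarrow> \<sigma> *\<^sub>R axis k 1 \<in> A"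
    and B: "compact B" and slab: "\<And>b. b \<in> B \<Longrightarrow> \<bar>b $ k\<bar> \<le> \<beta>" and \<beta>: "0 < \<beta>" "\<beta> < 1"
    and K: "convex_body K"
  shows "\<exists>t. measure lebesgue (B + stretch k 0 t ` K) < measure lebesgue (A + stretch k 0 t ` K)"
proof -
  \<comment> \<open>\<open>p\<close> overwrites coordinate \<open>k\<close> of \<open>x\<close> by
    \<sigma>. Hence \<open>D\<close> is the cylinder whose base is the projection of
    \<open>K\<close> and whose coordinate \<open>k\<close> runs over [-1, 1].\<close>
  define p where "p = (\<lambda>\<sigma> x. \<sigma> *\<^sub>R axis k 1 + stretch k 0 1 x)"
  define D where "D = (\<lambda>(\<sigma>, x). p \<sigma> x) ` ({-1..1} \<times> K)"
  have p_nth: "p \<sigma> x $ i = (if i = k then \<sigma> else x $ i)" for \<sigma> x i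
    by (simp add: p_def axis_def)
  have D_I: "p \<sigma> x \<in> D" if "\<bar>\<sigma>\<bar> \<le> 1" "x \<in> K" for \<sigma> x
    using that unfolding D_def by (intro image_eqI[of _ _ "(\<sigma>, x)"]) (auto simp: abs_le_iff)
  have "compact K" "convex K" "interior K \<noteq> {}"
    using K by (auto simp: convex_body_def)
  then obtain m r where r: "r > 0" "ball m r \<subseteq> K"
    by (metis ex_in_conv mem_interior)
  have contS: "continuous_on X (stretch k s t)" for X s t
    by (simp add: linear_continuous_on linear_stretch linear_conv_bounded_linear[symmetric])
  have "compact D"
    unfolding D_def p_def case_prod_unfold using \<open>compact K\<close>
    by (intro compact_continuous_image compact_Times compact_Icc continuous_intros
        continuous_on_compose2[OF contS[of UNIV]]) auto
  then have D: "D \<in> lmeasurable" by (rule lmeasurable_compact)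
  \<comment> \<open>The centre has coordinate \<open>k\<close> equal to 0, so radius at most 1 keeps
    the height in range. Moving \<open>m\<close> by the displacement of \<open>y\<close> stays in
    \<open>K\<close>, and \<open>p\<close> then corrects coordinate \<open>k\<close>.\<close>
  have "ball (stretch k 0 1 m) (min r 1) \<subseteq> D"
  proof
    fix y assume "y \<in> ball (stretch k 0 1 m) (min r 1)"
    then have n: "norm (y - stretch k 0 1 m) < min r 1"
      by (simp add: dist_norm norm_minus_commute)
    have "\<bar>y $ k\<bar> \<le> 1"
      using component_le_norm_cart[of "y - stretch k 0 1 m" k] n by simp
    moreover have "m + (y - stretch k 0 1 m) \<in> K"
      using n r by (auto simp: dist_norm norm_minus_commute)
    moreover have "y = p (y $ k) (m + (y - stretch k 0 1 m))"
      by (simp add: vec_eq_iff p_nth)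
    ultimately show "y \<in> D"
      by (metis D_I)
  qed
  then have "\<not> negligible D"
    using open_not_negligible[OF open_ball] r negligible_subset
    by (metis ball_eq_empty less_numeral_extra(1) min_less_iff_conj not_le)
  then have Dpos: "measure lebesgue D > 0"
    using negligible_iff_measure0[OF D] by (simp add: zero_less_measure_iff)
  obtain R where R: "R > 0" "\<And>b. b \<in> B \<Longrightarrow> norm b \<le> R"
    using compact_imp_bounded[OF B] by (meson bounded_pos)
  \<comment> \<open>Chosen so that \<open>b / c\<close> has norm below \<open>r\<close> for every
    \<open>b\<close> in \<open>B\<close>, which places \<open>m + b / c\<close> in \<open>K\<close>.
    The summand 1 makes the bound strict.\<close>
  define c where "c = (R + 1) / r"
  have c: "c > 0" using R r by (simp add: c_def)
  obtain t where t: "t > 0" "\<beta> * (t + c) ^ (CARD('n) - 1) < t ^ (CARD('n) - 1)"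
    using exists_power_gt[OF \<beta>(2)] by blast
  have lower: "stretch k 1 t ` D \<subseteq> A + stretch k 0 t ` K"
  proof -
    have "stretch k 1 t (p \<sigma> x) \<in> A + stretch k 0 t ` K" if "\<bar>\<sigma>\<bar> \<le> 1" "x \<in> K" for \<sigma> x
    proof -
      have "stretch k 1 t (p \<sigma> x) = \<sigma> *\<^sub>R axis k 1 + stretch k 0 t x"
        by (simp add: vec_eq_iff p_nth axis_def)
      then show ?thesis using seg that by (auto intro: set_plus_intro)
    qed
    then show ?thesis by (auto simp: D_def abs_le_iff)
  qed
  have upper: "B + stretch k 0 t ` K \<subseteq> (+) (- stretch k 0 c m) ` stretch k \<beta> (t + c) ` D"
  proof -
    have "b + stretch k 0 t x \<in> (+) (- stretch k 0 c m) ` stretch k \<beta> (t + c) ` D"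
      if b: "b \<in> B" and x: "x \<in> K" for b x
    proof -
      define y where "y = m + b /\<^sub>R c"
      have "norm b < R + 1" using R(2)[OF b] by simp
      then have "norm (b /\<^sub>R c) < r"
        using r R by (simp add: c_def divide_simps mult.commute)
      then have y: "y \<in> K" using r by (auto simp: y_def dist_norm)
      \<comment> \<open>Convexity gives \<open>t x + c y = (t + c) z\<close> with \<open>z\<close>
        in \<open>K\<close>. As \<open>c y = c m + b\<close>, the surplus \<open>c m\<close> is what
        the translation removes. This governs all coordinates but \<open>k\<close>, where the height
        \<open>b $ k / \<beta>\<close> is prescribed through \<open>p\<close>.\<close>
      define z where "z = (t / (t + c)) *\<^sub>R x + (c / (t + c)) *\<^sub>R y"
      have z: "z \<in> K" unfolding z_def
        using t(1) c by (intro convexD[OF \<open>convex K\<close> x y]) (auto simp: add_divide_distrib[symmetric])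
      have z': "(t + c) *\<^sub>R z = t *\<^sub>R x + c *\<^sub>R m + b"
        using t(1) c by (simp add: z_def y_def scaleR_add_right)
      have z_nth: "(t + c) * z $ i = t * x $ i + c * m $ i + b $ i" for i
        using arg_cong[OF z', of "\<lambda>v. v $ i"] by simp
      have "\<bar>b $ k / \<beta>\<bar> \<le> 1" using slab[OF b] \<beta> by simp
      then have "p (b $ k / \<beta>) z \<in> D"
        using z by (rule D_I)
      moreover have "b + stretch k 0 t x = - stretch k 0 c m + stretch k \<beta> (t + c) (p (b $ k / \<beta>) z)"
        using \<beta> by (simp add: vec_eq_iff p_nth z_nth)
      ultimately show ?thesis by blast
    qed
    then show ?thesis by (auto elim!: set_plus_elim)
  qed
  have lmS: "stretch k s t ` D \<in> lmeasurable" for s t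
    by (intro lmeasurable_compact compact_continuous_image contS \<open>compact D\<close>)
  have lmP: "X + stretch k 0 t ` K \<in> lmeasurable" if "compact X" for X
    by (intro lmeasurable_compact compact_set_plus compact_continuous_image contS \<open>compact K\<close> that)
  have "measure lebesgue (B + stretch k 0 t ` K)
      \<le> measure lebesgue ((+) (- stretch k 0 c m) ` stretch k \<beta> (t + c) ` D)"
    by (intro measure_mono_fmeasurable upper fmeasurableD lmP B measurable_translation lmS)
  also have "\<dots> = \<beta> * (t + c) ^ (CARD('n) - 1) * measure lebesgue D"
    using \<beta> t c by (simp only: measure_translation measure_stretch_image[OF D] abs_of_pos add_pos_pos)
  also have "\<dots> < t ^ (CARD('n) - 1) * measure lebesgue D"
    using t(2) Dpos by (rule mult_strict_right_mono)
  also have "\<dots> = measure lebesgue (stretch k 1 t ` D)"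
    using t by (simp add: measure_stretch_image[OF D])
  also have "\<dots> \<le> measure lebesgue (A + stretch k 0 t ` K)"
    by (intro measure_mono_fmeasurable lower fmeasurableD lmP A lmS)
  finally show ?thesis by blast
qed

section \<open>Linear changes of coordinates and their effect on volume\<close>

lemma exists_adapted_coordinates:
  fixes a u :: "real ^ 'n" and k :: 'n
  assumes "u \<bullet> a = 1"
  obtains T where "linear T" "inj T" "T (axis k 1) = a" "\<And>x. u \<bullet> T x = x $ k"
proof -
  define e where "e = norm u *\<^sub>R (axis k 1 :: real ^ 'n)"
  have "norm e = norm u" by (simp add: e_def)
  then obtain P where P: "orthogonal_transformation P" "P e = u"
    by (rule orthogonal_transformation_exists)
  have linP: "linear P" using P(1) by (rule orthogonal_transformation_linear)
  \<comment> \<open>\<open>P\<close> already turns the functional \<open>u\<close> into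
    \<open>norm u\<close> times coordinate \<open>k\<close>. The rank-one correction moves the image
    of the axis vector to \<open>a\<close>; it adds \<open>(1 - norm u) * x $ k\<close> to the
    functional, leaving exactly \<open>x $ k\<close>.\<close>
  define T where "T = (\<lambda>x. P x + x $ k *\<^sub>R (a - P (axis k 1)))"
  have uP: "u \<bullet> P x = norm u * x $ k" for x
  proof -
    have "u \<bullet> P x = P e \<bullet> P x" by (simp add: P(2))
    also have "\<dots> = e \<bullet> x"
      using P(1) by (simp add: orthogonal_transformation_def)
    finally show ?thesis by (simp add: e_def inner_axis')
  qed
  have uT: "u \<bullet> T x = x $ k" for x
    by (simp add: T_def inner_add_right inner_diff_right uP assms algebra_simps axis_def)
  have linT: "linear T"
    unfolding T_def by (intro linear_compose_add linP linearI) (auto simp: algebra_simps)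
  have "inj T"
  proof (subst linear_injective_0[OF linT], intro allI impI)
    fix x assume x: "T x = 0"
    then have "x $ k = 0" using uT[of x] by simp
    then have "P x = 0" using x by (simp add: T_def)
    then have "norm x = 0" using orthogonal_transformation_norm[OF P(1), of x] by simp
    then show "x = 0" by simp
  qed
  moreover have "T (axis k 1) = a" by (simp add: T_def)
  ultimately show thesis using that linT uT by blast
qed

text \<open>\<open>measure_shear_interval\<close> asks for a nonnegative lower bound in coordinate
  \<open>n\<close>. Translating the box makes that bound 0, and by linearity the shear turns a
  translation into another translation.\<close>

lemma measure_shear_cbox:
  fixes a b :: "real ^ 'n"
  assumes "m \<noteq> n"
  shows "measure lebesgue ((\<lambda>x. \<chi> i. if i = m then x $ m + x $ n else x $ i) ` cbox a b) =
    measure lebesgue (cbox a b)"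
proof (cases "cbox a b = {}")
  case False
  let ?h = "\<lambda>x :: real ^ 'n. \<chi> i. if i = m then x $ m + x $ n else x $ i"
  define a' b' where "a' = a - a $ n *\<^sub>R axis n 1" and "b' = b - a $ n *\<^sub>R axis n 1"
  have shift: "cbox a b = (+) (a $ n *\<^sub>R axis n 1) ` cbox a' b'"
    by (simp add: a'_def b'_def cbox_translation[symmetric])
  have "?h ` (+) v ` S = (+) (?h v) ` ?h ` S" for v S
    by (auto simp: image_image vec_eq_iff intro!: image_cong)
  then have "measure lebesgue (?h ` cbox a b) = measure lebesgue (?h ` cbox a' b')"
    by (simp only: shift measure_translation)
  also have "\<dots> = measure lebesgue (cbox a' b')"
    using False by (intro measure_shear_interval assms) (auto simp: shift a'_def)
  finally show ?thesis by (simp only: shift measure_translation)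
qed simp

text \<open>The image is the box with transposed corners: one inclusion is direct, the other follows
  because the map is an involution. The side lengths are merely permuted.\<close>

lemma measure_transpose_cbox:
  fixes a b :: "real ^ 'n"
  shows "measure lebesgue ((\<lambda>x. \<chi> i. x $ Transposition.transpose m n i) ` cbox a b) =
    measure lebesgue (cbox a b)"
proof (cases "cbox a b = {}")
  case False
  let ?\<tau> = "Transposition.transpose m n"
  let ?h = "\<lambda>x :: real ^ 'n. \<chi> i. x $ ?\<tau> i"
  have hh: "?h (?h x) = x" for x by (simp add: vec_eq_iff)
  have sub: "?h ` cbox c d \<subseteq> cbox (?h c) (?h d)" for c d
    by (auto simp: mem_box_cart)
  have "cbox (?h a) (?h b) \<subseteq> ?h ` cbox a b"
    using image_mono[OF sub[of "?h a" "?h b"], of ?h] by (simp only: image_image hh image_ident)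
  with sub have eq: "?h ` cbox a b = cbox (?h a) (?h b)" by blast
  have "(\<Prod>i\<in>UNIV. b $ ?\<tau> i - a $ ?\<tau> i) = (\<Prod>i\<in>UNIV. b $ i - a $ i)"
    by (rule prod.reindex_bij_betw) simp
  moreover have "cbox (?h a) (?h b) \<noteq> {}" using False eq by blast
  ultimately show ?thesis using False by (simp add: eq content_cbox_cart)
qed simp

text \<open>Replaces \<open>measure_linear_image\<close>, whose index type must be well-ordered.\<close>

lemma linear_image_measure_factor:
  fixes f :: "real ^ 'n \<Rightarrow> real ^ 'n"
  assumes "linear f"
  shows "\<exists>c. \<forall>S\<in>lmeasurable. f ` S \<in> lmeasurable \<and> measure lebesgue (f ` S) = c * measure lebesgue S"
proof -
  \<comment> \<open>Measurability of the image is kept inside \<open>P\<close> so that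
    \<open>P\<close> passes to compositions in the induction over elementary maps.\<close>
  define P :: "(real ^ 'n \<Rightarrow> real ^ 'n) \<Rightarrow> bool" where
    "P f \<longleftrightarrow> (\<exists>c. \<forall>S\<in>lmeasurable. f ` S \<in> lmeasurable \<and> measure lebesgue (f ` S) = c * measure lebesgue S)" for f
  have P_I: "P f" if "\<And>S. S \<in> lmeasurable \<Longrightarrow> f ` S \<in> lmeasurable"
    "\<And>S. S \<in> lmeasurable \<Longrightarrow> measure lebesgue (f ` S) = c * measure lebesgue S" for f c
    using that unfolding P_def by blast
  have P_cbox: "P f" if "linear f"
    "\<And>a b. measure lebesgue (f ` cbox a b) = measure lebesgue (cbox a b)" for f
  proof (rule P_I[of _ 1])
    fix S :: "(real ^ 'n) set" assume S: "S \<in> lmeasurable"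
    have "measure lebesgue (f ` cbox a b) = 1 * measure lebesgue (cbox a b)" for a b
      using that(2) by simp
    note * = measure_linear_sufficient[OF that(1) S this]
    show "f ` S \<in> lmeasurable" by (rule conjunct1[OF *])
    show "measure lebesgue (f ` S) = 1 * measure lebesgue S" by (rule conjunct2[OF *, symmetric])
  qed
  have "P f"
  proof (rule induct_linear_elementary[OF assms, of P])
    fix f g :: "real ^ 'n \<Rightarrow> real ^ 'n"
    assume "P f" "P g"
    from \<open>P f\<close> obtain c where
      c: "\<forall>S\<in>lmeasurable. f ` S \<in> lmeasurable \<and> measure lebesgue (f ` S) = c * measure lebesgue S"
      unfolding P_def ..
    from \<open>P g\<close> obtain d where
      d: "\<forall>S\<in>lmeasurable. g ` S \<in> lmeasurable \<and> measure lebesgue (g ` S) = d * measure lebesgue S"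
      unfolding P_def ..
    show "P (f \<circ> g)"
    proof (rule P_I[of _ "c * d"])
      fix S :: "(real ^ 'n) set" assume S: "S \<in> lmeasurable"
      have eq: "(f \<circ> g) ` S = f ` g ` S" by (rule image_comp[symmetric])
      note gS = bspec[OF d S]
      note fgS = bspec[OF c conjunct1[OF gS]]
      show "(f \<circ> g) ` S \<in> lmeasurable" unfolding eq by (rule conjunct1[OF fgS])
      show "measure lebesgue ((f \<circ> g) ` S) = c * d * measure lebesgue S"
        unfolding eq conjunct2[OF fgS] conjunct2[OF gS] by (rule mult.assoc[symmetric])
    qed
  next
    fix f :: "real ^ 'n \<Rightarrow> real ^ 'n" and i
    assume f: "linear f" "\<And>x. f x $ i = 0"
    \<comment> \<open>The range misses every vector with nonzero coordinate \<open>i\<close>, so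
      \<open>f\<close> is not onto and, being linear, not injective. All images are null sets and
      the factor is 0.\<close>
    then have "\<not> inj f"
      by (metis linear_injective_imp_surjective one_neq_zero surjE vec_component)
    then have "negligible (f ` S)" for S
      using f(1) negligible_linear_singular_image by blast
    then show "P f"
      by (intro P_I[of _ 0]) (simp_all add: negligible_imp_measure0 negligible_imp_measurable)
  next
    show "P (\<lambda>x. \<chi> i. c i * x $ i)" for c
      by (intro P_I[of _ "\<bar>prod c UNIV\<bar>"] measurable_stretch measure_stretch)
  next
    fix m n :: 'n
    show "P (\<lambda>x. \<chi> i. x $ Transposition.transpose m n i)"
      by (intro P_cbox linearI measure_transpose_cbox) (simp_all add: vec_eq_iff)
  next
    fix m n :: 'n
    assume mn: "m \<noteq> n"
    show "P (\<lambda>x. \<chi> i. if i = m then x $ m + x $ n else x $ i)"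
      by (intro P_cbox linearI measure_shear_cbox mn) (simp_all add: vec_eq_iff algebra_simps)
  qed
  then show ?thesis unfolding P_def .
qed

text \<open>An injective linear endomorphism is open, so the image of the unit ball has positive
  volume; this rules out a factor of 0 or below.\<close>

lemma inj_linear_image_measure_factor:
  fixes f :: "real ^ 'n \<Rightarrow> real ^ 'n"
  assumes "linear f" "inj f"
  obtains c where "c > 0" "\<And>S. S \<in> lmeasurable \<Longrightarrow> measure lebesgue (f ` S) = c * measure lebesgue S"
proof -
  obtain c where c: "\<And>S. S \<in> lmeasurable \<Longrightarrow> measure lebesgue (f ` S) = c * measure lebesgue S"
    using linear_image_measure_factor[OF assms(1)] by blast
  let ?B = "ball 0 1 :: (real ^ 'n) set"
  have B: "measure lebesgue ?B > 0" by (simp add: content_ball_pos)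
  have "open (f ` ?B)"
    using assms by (intro open_surjective_linear_image linear_inj_imp_surj) auto
  then have "\<not> negligible (f ` ?B)"
    by (intro open_not_negligible) auto
  moreover have "f ` ?B \<in> lmeasurable"
    using linear_image_measure_factor[OF assms(1)] lmeasurable_ball by blast
  ultimately have "measure lebesgue (f ` ?B) > 0"
    by (simp add: negligible_iff_measure0 zero_less_measure_iff)
  then have "c > 0" using B by (simp add: c zero_less_mult_iff)
  with c show thesis using that by blast
qed

section \<open>The volume gap in general position\<close>

lemma compact_linear_image:
  fixes f :: "'a::euclidean_space \<Rightarrow> 'b::real_normed_vector"
  shows "linear f \<Longrightarrow> compact S \<Longrightarrow> compact (f ` S)"
  by (simp add: compact_continuous_image linear_continuous_on linear_conv_bounded_linear)

lemma linear_image_set_plus: "linear f \<Longrightarrow> f ` (S + T) = f ` S + f ` T"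
  by (auto 0 3 simp: linear_add elim!: set_plus_elim)
    (metis imageI linear_add set_plus_intro)

text \<open>In the coordinates given by \<open>T\<close>, \<open>u\<close> becomes coordinate
  \<open>k\<close> and \<open>a\<close> the axis vector. All volumes change by the same positive
  factor, so the strict inequality carries over. Only \<open>A\<close> and \<open>B\<close> are
  pulled back; \<open>T\<close> is absorbed into \<open>L\<close>.\<close>

lemma slab_gap:
  fixes A B K :: "(real ^ 'n) set" and a u :: "real ^ 'n"
  assumes A: "compact A" and seg: "\<And>\<sigma>. \<bar>\<sigma>\<bar> \<le> 1 \<Longrightarrow> \<sigma> *\<^sub>R a \<in> A"
    and B: "compact B" and slab: "\<And>b. b \<in> B \<Longrightarrow> \<bar>u \<bullet> b\<bar> \<le> \<beta>" and \<beta>: "0 < \<beta>" "\<beta> < 1"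
    and u: "u \<bullet> a = 1" and K: "convex_body K"
  shows "\<exists>L. linear L \<and> measure lebesgue (B + L ` K) < measure lebesgue (A + L ` K)"
proof -
  \<comment> \<open>Any index will do.\<close>
  fix k :: 'n
  obtain T where T: "linear T" "inj T" "T (axis k 1) = a" "\<And>x. u \<bullet> T x = x $ k"
    using exists_adapted_coordinates[OF u, of k] by blast
  have linI: "linear (inv T)" using T by (simp add: inj_linear_imp_inv_linear)
  have surj: "T (inv T x) = x" for x
    using linear_inj_imp_surj[OF T(1,2)] by (rule surj_f_inv_f)
  have TI: "T ` inv T ` X = X" for X
    by (simp add: image_comp o_def surj)
  have cI: "compact (inv T ` X)" if "compact X" for X
    using that linI by (simp add: compact_linear_image)
  have segI: "\<sigma> *\<^sub>R axis k 1 \<in> inv T ` A" if "\<bar>\<sigma>\<bar> \<le> 1" for \<sigma>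
  proof -
    have "T (\<sigma> *\<^sub>R axis k 1) = \<sigma> *\<^sub>R a" using T by (simp add: linear_scale)
    then show ?thesis using seg[OF that] T(2) by (metis image_eqI inv_f_f)
  qed
  have slabI: "\<bar>b $ k\<bar> \<le> \<beta>" if "b \<in> inv T ` B" for b
    using that slab by (auto simp: T(4)[symmetric] surj)
  obtain t where t: "measure lebesgue (inv T ` B + stretch k 0 t ` K)
      < measure lebesgue (inv T ` A + stretch k 0 t ` K)"
    using stretch_gap[OF cI[OF A] segI cI[OF B] slabI \<beta> K] by blast
  obtain \<gamma> where \<gamma>: "\<gamma> > 0"
    "\<And>S. S \<in> lmeasurable \<Longrightarrow> measure lebesgue (T ` S) = \<gamma> * measure lebesgue S"
    using inj_linear_image_measure_factor[OF T(1,2)] by blast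
  have m: "measure lebesgue (X + (T \<circ> stretch k 0 t) ` K)
      = \<gamma> * measure lebesgue (inv T ` X + stretch k 0 t ` K)" if "compact X" for X
  proof -
    have "X + (T \<circ> stretch k 0 t) ` K = T ` (inv T ` X + stretch k 0 t ` K)"
      by (simp only: linear_image_set_plus[OF T(1)] TI image_comp[symmetric])
    moreover have "inv T ` X + stretch k 0 t ` K \<in> lmeasurable"
      using K cI[OF that] unfolding convex_body_def
      by (intro lmeasurable_compact compact_set_plus compact_linear_image[OF linear_stretch]) auto
    ultimately show ?thesis by (simp only: \<gamma>(2))
  qed
  have "measure lebesgue (B + (T \<circ> stretch k 0 t) ` K)
      < measure lebesgue (A + (T \<circ> stretch k 0 t) ` K)"
    using t \<gamma>(1) by (simp only: m A B mult_less_cancel_left_pos)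
  moreover have "linear (T \<circ> stretch k 0 t)"
    using linear_stretch T(1) by (rule linear_compose)
  ultimately show ?thesis by blast
qed

lemma symmetric_convex_body_scaleR_mem:
  assumes "convex_body A" "centrally_symmetric A" "a \<in> A" "\<bar>\<sigma>\<bar> \<le> 1"
  shows "\<sigma> *\<^sub>R a \<in> A"
proof -
  have "- a \<in> A" using assms(2,3) unfolding centrally_symmetric_def by auto
  then have "((1 + \<sigma>) / 2) *\<^sub>R a + ((1 - \<sigma>) / 2) *\<^sub>R (- a) \<in> A"
    using assms by (intro convexD) (auto simp: convex_body_def field_simps abs_le_iff)
  moreover have "((1 + \<sigma>) / 2) *\<^sub>R a + ((1 - \<sigma>) / 2) *\<^sub>R (- a) = \<sigma> *\<^sub>R a"
    by (simp add: scaleR_left_diff_distrib[symmetric] field_simps)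
  ultimately show ?thesis by simp
qed

text \<open>Separation of \<open>a\<close> from the closed set \<open>B\<close> is strict, which
  leaves room to fatten \<open>B\<close> by a small ball before applying
  \<open>slab_gap\<close>.\<close>

lemma thickened_gap:
  fixes A B K :: "(real ^ 'n) set"
  assumes A: "convex_body A" "centrally_symmetric A"
    and B: "convex_body B" "centrally_symmetric B"
    and K: "convex_body K" and "\<not> A \<subseteq> B"
  obtains L \<delta> where "linear L" "\<delta> > 0"
    "measure lebesgue (B + cball 0 \<delta> + L ` K) < measure lebesgue (A + L ` K)"
proof -
  obtain a where a: "a \<in> A" "a \<notin> B" using \<open>\<not> A \<subseteq> B\<close> by blast
  have cB: "compact B" "convex B" "closed B"
    using B by (auto simp: convex_body_def compact_imp_closed)
  obtain v d where vd: "v \<bullet> a < d" "\<And>x. x \<in> B \<Longrightarrow> d < v \<bullet> x"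
    using separating_hyperplane_closed_point[OF cB(2,3) a(2)] by blast
  have symB: "- x \<in> B" if "x \<in> B" for x
    using B(2) that unfolding centrally_symmetric_def by auto
  obtain x0 where "x0 \<in> B" using B by (auto simp: convex_body_def dest: interior_subset[THEN subsetD])
  \<comment> \<open>Adding the bounds at \<open>x0\<close> and \<open>- x0\<close> gives
    \<open>2 d < 0\<close>. Both \<open>d\<close> and \<open>v \<bullet> a\<close> are thus
    negative, and dividing \<open>v\<close> by the latter normalises \<open>u \<bullet> a\<close> to
    1.\<close>
  then have "d < 0" using vd(2)[of x0] vd(2)[OF symB, of x0] by simp
  define s where "s = v \<bullet> a"
  have s: "s < 0" "s < d" using vd(1) \<open>d < 0\<close> by (auto simp: s_def)
  define u where "u = v /\<^sub>R s"
  have ua: "u \<bullet> a = 1" using s by (simp add: u_def s_def[symmetric])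
  have ub: "\<bar>u \<bullet> b\<bar> \<le> d / s" if "b \<in> B" for b
  proof -
    have "d < v \<bullet> b" "v \<bullet> b < - d" using vd(2)[OF that] vd(2)[OF symB[OF that]] by auto
    then have "\<bar>v \<bullet> b\<bar> \<le> - d" by (simp add: abs_le_iff)
    moreover have "\<bar>u \<bullet> b\<bar> = \<bar>v \<bullet> b\<bar> / (- s)"
      using s by (simp add: u_def abs_mult divide_inverse_commute)
    ultimately show ?thesis using s by (simp add: field_simps)
  qed
  have "0 < d / s" "d / s < 1"
    using s \<open>d < 0\<close> by (auto simp: divide_neg_neg field_simps)
  moreover from this(2) obtain \<beta> where "d / s < \<beta>" "\<beta> < 1"
    using dense by blast
  ultimately have \<beta>: "0 < \<beta>" "\<beta> < 1" "d / s < \<beta>" by auto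
  \<comment> \<open>By Cauchy-Schwarz, a ball of this radius widens the slab from
    \<open>d / s\<close> to exactly \<beta>.\<close>
  define \<delta> where "\<delta> = (\<beta> - d / s) / norm u"
  have "u \<noteq> 0" using ua by auto
  then have \<delta>: "\<delta> > 0" "norm u * \<delta> = \<beta> - d / s" using \<beta>(3) by (auto simp: \<delta>_def)
  have slab: "\<bar>u \<bullet> y\<bar> \<le> \<beta>" if y_in: "y \<in> B + cball 0 \<delta>" for y
  proof -
    obtain b e where y: "y = b + e" "b \<in> B" and "e \<in> cball 0 \<delta>"
      using y_in by (rule set_plus_elim)
    then have "norm e \<le> \<delta>" by simp
    have "\<bar>u \<bullet> e\<bar> \<le> norm u * norm e" by (rule Cauchy_Schwarz_ineq2)
    also have "\<dots> \<le> \<beta> - d / s" unfolding \<delta>(2)[symmetric] using \<open>norm e \<le> \<delta>\<close> by (intro mult_left_mono) auto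
    finally show ?thesis using ub[OF y(2)] by (simp add: y(1) inner_add_right)
  qed
  have "compact A" using A by (simp add: convex_body_def)
  then obtain L where
    "linear L" "measure lebesgue (B + cball 0 \<delta> + L ` K) < measure lebesgue (A + L ` K)"
    using slab_gap[OF _ symmetric_convex_body_scaleR_mem[OF A a(1)]
        compact_set_plus[OF cB(1) compact_cball] slab \<beta>(1,2) ua K] by auto
  then show thesis using that \<delta>(1) by simp
qed

section \<open>From the gap to the two inclusions\<close>

theorem theorem1p3:
  fixes A B :: "(real ^ 'n) set"
  assumes "convex_body A" and "centrally_symmetric A"
    and "convex_body B" and "centrally_symmetric B"
  shows "((\<forall>K :: (real ^ 'n) set. convex_body K \<longrightarrow> measure lebesgue (A + K) \<le> measure lebesgue (B + K)) \<longrightarrow> A \<subseteq> B)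
    \<and> (\<forall>K\<^sub>0 :: (real ^ 'n) set. convex_body K\<^sub>0 \<longrightarrow>
          (\<forall>L :: real ^ 'n \<Rightarrow> real ^ 'n. linear L \<longrightarrow> measure lebesgue (A + L ` K\<^sub>0) \<le> measure lebesgue (B + L ` K\<^sub>0)) \<longrightarrow>
          A \<subseteq> B)"
proof (intro conjI allI impI)
  have lm: "X + Y \<in> lmeasurable" if "compact X" "compact Y" for X Y :: "(real ^ 'n) set"
    using that by (intro lmeasurable_compact compact_set_plus)
  have comp: "compact A" "compact B" using assms by (auto simp: convex_body_def)
  have thicken: "X + Y \<subseteq> X + (cball 0 \<delta> + Y)" if "\<delta> > 0" for X Y :: "(real ^ 'n) set" and \<delta>
    using that by (intro set_plus_mono2 order_refl set_zero_plus2) auto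
  {
    assume le: "\<forall>K :: (real ^ 'n) set. convex_body K \<longrightarrow> measure lebesgue (A + K) \<le> measure lebesgue (B + K)"
    show "A \<subseteq> B"
    proof (rule ccontr)
      assume "\<not> A \<subseteq> B"
      then obtain L \<delta> where L: "linear L" "\<delta> > 0"
        "measure lebesgue (B + cball 0 \<delta> + L ` A) < measure lebesgue (A + L ` A)"
        using thickened_gap[OF assms assms(1)] by blast
      \<comment> \<open>Any convex body could be flattened here, and \<open>A\<close> is at hand.
        Its image under \<open>L\<close> may have empty interior; adding the ball repairs
        this.\<close>
      define K where "K = cball 0 \<delta> + L ` A"
      have LA: "compact (L ` A)" "convex (L ` A)" "L ` A \<noteq> {}"
        using assms(1) L(1)
        by (auto simp: convex_body_def compact_linear_image convex_linear_image)
      then have "compact K" unfolding K_def by (intro compact_set_plus compact_cball)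
      moreover have "interior K \<noteq> {}"
      proof -
        obtain z where "z \<in> L ` A" using LA by blast
        then have "(+) z ` cball 0 \<delta> \<subseteq> K" by (force simp: K_def set_plus_def)
        then have "ball z \<delta> \<subseteq> interior K"
          using interior_mono[of "cball z \<delta>" K] by (simp add: cball_translation[symmetric])
        then show ?thesis using L(2) by (metis centre_in_ball empty_iff subsetD)
      qed
      ultimately have "convex_body K"
        using LA by (simp add: convex_body_def K_def convex_set_plus)
      then have "measure lebesgue (A + K) \<le> measure lebesgue (B + K)" using le by blast
      \<comment> \<open>The ball contains 0, so it can only enlarge the sum with \<open>A\<close>;
        in the sum with \<open>B\<close> the gap already accounts for it.\<close>
      moreover have "measure lebesgue (A + L ` A) \<le> measure lebesgue (A + K)"
        using \<open>compact K\<close> comp LA thicken[OF L(2)]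
        by (intro measure_mono_fmeasurable fmeasurableD lm) (auto simp: K_def)
      ultimately show False using L(3) by (simp add: K_def add.assoc)
    qed
  next
    fix K\<^sub>0 :: "(real ^ 'n) set"
    assume K: "convex_body K\<^sub>0"
      and le: "\<forall>L :: real ^ 'n \<Rightarrow> real ^ 'n. linear L \<longrightarrow> measure lebesgue (A + L ` K\<^sub>0) \<le> measure lebesgue (B + L ` K\<^sub>0)"
    show "A \<subseteq> B"
    proof (rule ccontr)
      assume "\<not> A \<subseteq> B"
      then obtain L \<delta> where L: "linear L" "\<delta> > 0"
        "measure lebesgue (B + cball 0 \<delta> + L ` K\<^sub>0) < measure lebesgue (A + L ` K\<^sub>0)"
        using thickened_gap[OF assms K] by blast
      have "compact (L ` K\<^sub>0)" using K L(1) by (simp add: convex_body_def compact_linear_image)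
      \<comment> \<open>Here the test body must be a linear image itself, so the ball is dropped:
        without it the sum with \<open>B\<close> is no larger, and the gap persists.\<close>
      then have "measure lebesgue (B + L ` K\<^sub>0) \<le> measure lebesgue (B + (cball 0 \<delta> + L ` K\<^sub>0))"
        using comp thicken[OF L(2)]
        by (intro measure_mono_fmeasurable fmeasurableD lm compact_set_plus compact_cball) auto
      moreover have "measure lebesgue (A + L ` K\<^sub>0) \<le> measure lebesgue (B + L ` K\<^sub>0)"
        using le L(1) by blast
      ultimately show False using L(3) by (simp add: add.assoc)
    qed
  }
qed

end
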